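(* Let $m\ge 1$ be an integer, let $f_{m,n}(z)=\sum_{j=0}^{n}\binom{n}{j}z^{\binom{j}{m}}$ for $n\ge 0$, and let $$F_{m}(z,t)=\sum_{n=0}^{\infty}f_{m,n}(z)t^{n}.$$ Then for $|z|<1$ and $|t|<1/2$, $$z\frac{\partial F_{m}(z,t)}{\partial z}=(-t)^{m}\sum_{j=0}^{m}\frac{1}{j!}\binom{m}{j}(t-1)^{j}\frac{\partial^{j} F_{m}(z,t)}{\partial t^{j}}.$$
   Context: Here $z,t$ are complex variables. Conventions: $\binom{j}{m}=0$ for $0\le j<m$, and $z^0=1$. The $j=0$ derivative $\partial^0F_m/\partial t^0$ is $F_m$ itself. *)

theory Defs
  imports "HOL-Complex_Analysis.Complex_Analysis"
begin

definition f :: "nat \<Rightarrow> nat \<Rightarrow> complex \<Rightarrow> complex" where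
  "f m n z = (\<Sum>j=0..n. of_nat (n choose j) * z ^ (j choose m))"

definition F :: "nat \<Rightarrow> complex \<Rightarrow> complex \<Rightarrow> complex" where
  "F m z t = (\<Sum>n. f m n z * t ^ n)"

end

theory Submission
  imports Defs
begin

text \<open>
  By the Leibniz rule the right-hand side is \<open>(-t)^m / m!\<close> times the \<open>m\<close>-th \<open>t\<close>-derivative of
  \<open>(t - 1)^m F\<close>. Multiplication by \<open>(1 - t)^m\<close> takes \<open>m\<close>-th backward differences of the
  coefficients \<open>f m n z\<close>. As \<open>f m n z\<close> is the binomial transform of \<open>c j = z ^ (j choose m)\<close>, Pascal's
  rule turns the difference at index \<open>n + m\<close> into \<open>\<Sum>j\<le>n. (n choose j) * c (j + m)\<close>. Times
  \<open>(n + m) choose m\<close>, this is \<open>z\<close> times the derivative of \<open>f m (n + m) z\<close>.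
\<close>

section \<open>Binomial transforms and formal derivatives\<close>

lemma binomial_transform_diff:
  fixes c :: "nat \<Rightarrow> 'a::comm_ring_1"
  shows "(\<Sum>j\<le>Suc n. of_nat (Suc n choose j) * c j) - (\<Sum>j\<le>n. of_nat (n choose j) * c j) =
    (\<Sum>j\<le>n. of_nat (n choose j) * c (Suc j))"
proof -
  have "(\<Sum>j\<le>n. of_nat (n choose j) * c j) = (\<Sum>j\<le>Suc n. of_nat (n choose j) * c j)"
    by (simp add: binomial_eq_0)
  also have "\<dots> = c 0 + (\<Sum>j\<le>n. of_nat (n choose Suc j) * c (Suc j))"
    by (simp add: sum.atMost_Suc_shift del: sum.atMost_Suc)
  finally show ?thesis
    by (simp add: sum.atMost_Suc_shift algebra_simps sum.distrib del: sum.atMost_Suc)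
qed

text \<open>Each factor \<open>1 - fps_X\<close> takes one backward difference and so, by the
  previous lemma, shifts \<open>c\<close> by one place. Below index \<open>p\<close> the differences
  run into the start of the sequence, hence the index \<open>n + p\<close>.\<close>

lemma fps_one_minus_X_power_mult_binomial_transform:
  fixes c :: "nat \<Rightarrow> 'a::comm_ring_1"
  shows "fps_nth ((1 - fps_X) ^ p * Abs_fps (\<lambda>n. \<Sum>j\<le>n. of_nat (n choose j) * c j)) (n + p) =
    (\<Sum>j\<le>n. of_nat (n choose j) * c (j + p))"
proof (induction p arbitrary: n)
  case 0
  show ?case by simp
next
  case (Suc p)
  define Q where "Q = (1 - fps_X) ^ p * Abs_fps (\<lambda>n. \<Sum>j\<le>n. of_nat (n choose j) * c j)"
  have Q: "fps_nth Q (n + p) = (\<Sum>j\<le>n. of_nat (n choose j) * c (j + p))" for n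
    unfolding Q_def by (rule Suc.IH)
  have "(1 - fps_X) ^ Suc p * Abs_fps (\<lambda>n. \<Sum>j\<le>n. of_nat (n choose j) * c j) = Q - fps_X * Q"
    by (simp add: Q_def algebra_simps)
  then show ?case
    using binomial_transform_diff[of n "\<lambda>j. c (j + p)"] Q[of n] Q[of "Suc n"]
    by (simp del: sum.atMost_Suc binomial_Suc_Suc)
qed

text \<open>The falling factorial (n + k) ... (n + 1) is split into \<open>fact k\<close> and a
  binomial coefficient: the first cancels the factor 1/m! of the overview, the second is the one in
  \<open>z_times_deriv_f_add\<close>.\<close>

lemma fps_nth_deriv_nth:
  fixes A :: "'a::{comm_semiring_1, semiring_char_0} fps"
  shows "fps_nth (fps_nth_deriv k A) n = fact k * of_nat ((n + k) choose k) * fps_nth A (n + k)"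
proof (induction k arbitrary: A)
  case 0
  show ?case by simp
next
  case (Suc k)
  have "of_nat (Suc k * (Suc (n + k) choose Suc k)) = (of_nat (Suc (n + k) * ((n + k) choose k)) :: 'a)"
    by (simp only: Suc_times_binomial)
  then have eq: "of_nat (Suc k) * of_nat (Suc (n + k) choose Suc k) =
      (of_nat (Suc (n + k)) * of_nat ((n + k) choose k) :: 'a)"
    by (simp only: of_nat_mult)
  have "fps_nth (fps_nth_deriv (Suc k) A) n =
      fact k * (of_nat (Suc (n + k)) * of_nat ((n + k) choose k)) * fps_nth A (Suc (n + k))"
    by (simp add: Suc.IH mult_ac del: of_nat_Suc)
  also have "\<dots> = fact (Suc k) * of_nat (Suc (n + k) choose Suc k) * fps_nth A (Suc (n + k))"
    by (simp add: eq[symmetric] mult_ac del: of_nat_Suc binomial_Suc_Suc)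
  finally show ?case by simp
qed

section \<open>Higher derivatives of analytic functions\<close>

lemma fps_conv_radius_nth_deriv:
  fixes A :: "'a::{banach, real_normed_field} fps"
  shows "fps_conv_radius (fps_nth_deriv k A) \<ge> fps_conv_radius A"
proof (induction k arbitrary: A)
  case (Suc k)
  show ?case
    using Suc[of "fps_deriv A"] fps_conv_radius_deriv[of A] by simp
qed simp

lemma higher_deriv_eval_fps:
  fixes A :: "'a::{banach, real_normed_field} fps"
  assumes "norm w < fps_conv_radius A"
  shows "(deriv ^^ k) (eval_fps A) w = eval_fps (fps_nth_deriv k A) w"
  using assms
proof (induction k arbitrary: w)
  case (Suc k)
  \<comment> \<open>One more differentiation needs the induction hypothesis on a whole neighbourhood
    of \<open>w\<close>, not only at \<open>w\<close>.\<close>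
  have "\<forall>\<^sub>F x in nhds w. x \<in> eball 0 (fps_conv_radius A)"
    using Suc.prems by (intro eventually_nhds_in_open) auto
  then have "\<forall>\<^sub>F x in nhds w. (deriv ^^ k) (eval_fps A) x = eval_fps (fps_nth_deriv k A) x"
    by eventually_elim (simp add: Suc.IH)
  then have "(deriv ^^ Suc k) (eval_fps A) w = deriv (eval_fps (fps_nth_deriv k A)) w"
    by (simp add: deriv_cong_ev)
  also have "\<dots> = eval_fps (fps_deriv (fps_nth_deriv k A)) w"
    using Suc.prems fps_conv_radius_nth_deriv[of A k] by (intro eval_fps_deriv[symmetric]) auto
  finally show ?case by (simp only: fps_nth_deriv_commute)
qed simp

lemma higher_deriv_power_mult:
  fixes g :: "complex \<Rightarrow> complex"
  assumes "g holomorphic_on S" "open S" "t \<in> S"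
  shows "(deriv ^^ m) (\<lambda>w. (w - a) ^ m * g w) t =
    fact m * (\<Sum>j=0..m. 1 / fact j * of_nat (m choose j) * (t - a) ^ j * (deriv ^^ j) g t)"
proof -
  \<comment> \<open>With \<open>g\<close> as the first factor, the Leibniz index \<open>j\<close>
    counts the derivatives that fall on \<open>g\<close>.\<close>
  have "(deriv ^^ m) (\<lambda>w. g w * (w - a) ^ m) t =
      (\<Sum>j=0..m. of_nat (m choose j) * (deriv ^^ j) g t * (deriv ^^ (m - j)) (\<lambda>w. (w - a) ^ m) t)"
    using assms by (intro higher_deriv_mult[of _ S]) (auto intro!: holomorphic_intros)
  also have "\<dots> = (\<Sum>j=0..m. fact m *
      (1 / fact j * of_nat (m choose j) * (t - a) ^ j * (deriv ^^ j) g t))"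
  proof (rule sum.cong)
    fix j assume "j \<in> {0..m}"
    then have j: "j \<le> m" by simp
    \<comment> \<open>The Pochhammer symbol is (j + 1) ... m, the constant that appears when
      \<open>(w - a) ^ m\<close> is differentiated \<open>m - j\<close> times.\<close>
    have "fact m = fact j * (pochhammer (1 + of_nat j) (m - j) :: complex)"
      using pochhammer_product[OF j, of "1 :: complex"] by (simp add: pochhammer_fact)
    then have "(deriv ^^ (m - j)) (\<lambda>w. (w - a) ^ m) t = fact m / fact j * (t - a) ^ j"
      using j by (simp add: higher_deriv_power Suc_diff_le)
    then show "of_nat (m choose j) * (deriv ^^ j) g t * (deriv ^^ (m - j)) (\<lambda>w. (w - a) ^ m) t =
        fact m * (1 / fact j * of_nat (m choose j) * (t - a) ^ j * (deriv ^^ j) g t)"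
      by simp
  qed simp
  finally show ?thesis
    by (simp add: sum_distrib_left mult.commute)
qed

section \<open>Convergence and differentiability of \<open>F\<close>\<close>

lemma norm_f_le:
  assumes "norm z \<le> 1"
  shows "norm (f m n z) \<le> 2 ^ n"
proof -
  have "norm (f m n z) \<le> (\<Sum>j\<le>n. real (n choose j) * norm z ^ (j choose m))"
    unfolding f_def atMost_atLeast0 by (intro sum_norm_le) (simp add: norm_mult norm_power)
  also have "\<dots> \<le> (\<Sum>j\<le>n. real (n choose j) * 1)"
    using assms by (intro sum_mono mult_left_mono power_le_one) auto
  also have "\<dots> = real (\<Sum>j\<le>n. n choose j)"
    by simp
  also have "\<dots> = 2 ^ n"
    by (simp add: choose_row_sum)
  finally show ?thesis .
qed

text \<open>The bound is independent of \<open>z\<close>, so it serves both for convergence in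
  \<open>t\<close>, where it is geometric for |t| < 1/2, and as a majorant for differentiation in
  \<open>z\<close>.\<close>

lemma norm_f_term_le:
  assumes "norm z \<le> 1"
  shows "norm (f m n z * t ^ n) \<le> (2 * norm t) ^ n"
  using norm_f_le[OF assms, of m n]
  by (simp add: norm_mult norm_power power_mult_distrib mult_right_mono)

lemma summable_f_term:
  assumes "norm z \<le> 1" "norm t < 1 / 2"
  shows "summable (\<lambda>n. f m n z * t ^ n)"
proof (rule summable_comparison_test'[of "\<lambda>n. (2 * norm t) ^ n" 0])
  show "summable (\<lambda>n. (2 * norm t) ^ n)"
    using assms(2) by (intro summable_geometric) simp
qed (rule norm_f_term_le[OF assms(1)])

lemma fps_conv_radius_f:
  assumes "norm z \<le> 1"
  shows "fps_conv_radius (Abs_fps (\<lambda>n. f m n z)) \<ge> ereal (1 / 2)"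
  unfolding fps_conv_radius_def
  by (rule conv_radius_geI_ex') (use assms in \<open>auto intro!: summable_f_term\<close>)

lemma F_eq_eval_fps: "F m z = eval_fps (Abs_fps (\<lambda>n. f m n z))"
  by (simp add: F_def eval_fps_def fun_eq_iff)

lemma F_holomorphic:
  assumes "norm z \<le> 1"
  shows "F m z holomorphic_on ball 0 (1 / 2)"
  unfolding F_eq_eval_fps
proof (rule holomorphic_on_eval_fps, rule subsetI)
  fix w :: complex assume "w \<in> ball 0 (1 / 2)"
  then have "ereal (norm w) < ereal (1 / 2)" by simp
  also note fps_conv_radius_f[OF assms]
  finally show "w \<in> eball 0 (fps_conv_radius (Abs_fps (\<lambda>n. f m n z)))" by simp
qed

text \<open>Termwise differentiation in \<open>z\<close> is justified by the Weierstrass test, with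
  majorant \<open>(2 * norm t) ^ n\<close> on the unit disc.\<close>

lemma F_has_field_derivative:
  assumes "norm z < 1" "norm t < 1 / 2"
  obtains D where "((\<lambda>w. F m w t) has_field_derivative D) (at z)"
    "(\<lambda>n. deriv (f m n) z * t ^ n) sums D"
proof -
  have der: "((\<lambda>w. f m n w * t ^ n) has_field_derivative deriv (f m n) w * t ^ n) (at w)" for n w
  proof -
    have "f m n holomorphic_on UNIV"
      unfolding f_def by (intro holomorphic_intros)
    then show ?thesis
      by (intro DERIV_cmult_right holomorphic_derivI[of _ UNIV]) auto
  qed
  have "\<exists>g g'. \<forall>x\<in>ball 0 1. ((\<lambda>n. f m n x * t ^ n) sums g x) \<and>
      ((\<lambda>n. deriv (f m n) x * t ^ n) sums g' x) \<and> (g has_field_derivative g' x) (at x)"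
  proof (rule series_and_derivative_comparison_complex)
    fix x :: complex
    have "norm (f m n y * t ^ n) \<le> norm (complex_of_real ((2 * norm t) ^ n))"
      if "y \<in> ball x 1 \<inter> ball 0 1" for n y
      using norm_f_term_le[of y m n t] that by (simp add: norm_power norm_mult)
    moreover have "summable (\<lambda>n. complex_of_real ((2 * norm t) ^ n))"
      using assms(2) by (intro summable_of_real summable_geometric) simp
    ultimately show "\<exists>d h. 0 < d \<and> summable h \<and> range h \<subseteq> \<real>\<^sub>\<ge>\<^sub>0 \<and>
        (\<forall>\<^sub>F n in sequentially. \<forall>y\<in>ball x d \<inter> ball 0 1. cmod (f m n y * t ^ n) \<le> cmod (h n))"
      by (intro exI[of _ 1] exI[of _ "\<lambda>n. complex_of_real ((2 * norm t) ^ n)"])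
        (auto intro!: always_eventually simp del: of_real_power of_real_mult)
  qed (use der in auto)
  then obtain g g' where g: "\<And>x. x \<in> ball 0 1 \<Longrightarrow> (\<lambda>n. f m n x * t ^ n) sums g x"
      "\<And>x. x \<in> ball 0 1 \<Longrightarrow> (\<lambda>n. deriv (f m n) x * t ^ n) sums g' x"
      "\<And>x. x \<in> ball 0 1 \<Longrightarrow> (g has_field_derivative g' x) (at x)"
    by blast
  show thesis
  proof
    show "((\<lambda>w. F m w t) has_field_derivative g' z) (at z)"
      \<comment> \<open>The series is known to sum to \<open>g\<close> inside the unit disc; this
        contains a neighbourhood of \<open>z\<close>, which is enough to transfer the derivative to
        \<open>F\<close>.\<close>
      by (rule DERIV_cong_ev[THEN iffD1, OF refl _ refl g(3)[of z]])
        (use assms(1) g(1) in \<open>auto simp: F_def sums_iff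
          intro!: eventually_mono[OF eventually_nhds_in_open[of "ball 0 1"]]\<close>)
  qed (use assms(1) g(2) in auto)
qed

section \<open>The coefficients of z times the z-derivative of \<open>F\<close>\<close>

lemma z_times_deriv_f:
  "z * deriv (f m n) z =
    (\<Sum>j\<le>n. of_nat (n choose j) * of_nat (j choose m) * z ^ (j choose m))"
proof -
  have "(f m n has_field_derivative
      (\<Sum>j\<le>n. of_nat (n choose j) * (of_nat (j choose m) * z ^ ((j choose m) - 1)))) (at z)"
    unfolding f_def atMost_atLeast0 by (auto intro!: derivative_eq_intros sum.cong)
  then have "deriv (f m n) z =
      (\<Sum>j\<le>n. of_nat (n choose j) * (of_nat (j choose m) * z ^ ((j choose m) - 1)))"
    by (rule DERIV_imp_deriv)
  then have "z * deriv (f m n) z =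
      (\<Sum>j\<le>n. of_nat (n choose j) * (z * (of_nat (j choose m) * z ^ ((j choose m) - 1))))"
    by (simp add: sum_distrib_left mult.left_commute[of z])
  \<comment> \<open>For \<open>k = 0\<close> the truncated exponent \<open>k - 1\<close> is
    harmless, since the factor \<open>of_nat k\<close> vanishes.\<close>
  moreover have "z * (of_nat k * z ^ (k - 1)) = of_nat k * z ^ k" for k
    by (cases k) auto
  ultimately show ?thesis
    by (simp only: mult.assoc)
qed

lemma z_times_deriv_f_less:
  assumes "n < m"
  shows "z * deriv (f m n) z = 0"
  unfolding z_times_deriv_f using assms by (intro sum.neutral) auto

text \<open>Terms with \<open>j < m\<close> vanish. In the others, choosing a
  \<open>(j + m)\<close>-subset and then an \<open>m\<close>-subset of it amounts to choosing the
  \<open>m\<close>-subset first and then the remaining \<open>j\<close> elements, so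
  \<open>(n + m) choose m\<close> factors out.\<close>

lemma z_times_deriv_f_add:
  "z * deriv (f m (n + m)) z =
    of_nat ((n + m) choose m) * (\<Sum>j\<le>n. of_nat (n choose j) * z ^ ((j + m) choose m))"
proof -
  have "z * deriv (f m (n + m)) z =
      (\<Sum>j=m..n + m. of_nat ((n + m) choose j) * of_nat (j choose m) * z ^ (j choose m))"
    unfolding z_times_deriv_f by (rule sum.mono_neutral_right) auto
  also have "\<dots> = (\<Sum>j\<le>n. of_nat (((n + m) choose (j + m)) * ((j + m) choose m)) *
      z ^ ((j + m) choose m))"
    using sum.shift_bounds_cl_nat_ivl[of _ 0 m n] by (simp add: atMost_atLeast0)
  also have "\<dots> = (\<Sum>j\<le>n. of_nat (((n + m) choose m) * (n choose j)) * z ^ ((j + m) choose m))"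
    by (intro sum.cong) (auto simp: choose_mult simp del: of_nat_mult)
  finally show ?thesis
    by (simp add: sum_distrib_left mult.assoc)
qed

section \<open>The differential equation, by comparing coefficients in \<open>t\<close>\<close>

theorem corollary4p3:
  fixes m :: nat and z t :: complex
  assumes "m \<ge> 1" and "norm z < 1" and "norm t < 1 / 2"
  shows "summable (\<lambda>n. f m n z * t ^ n) \<and>
    (\<lambda>w. F m w t) field_differentiable (at z) \<and>
    (\<forall>j<m. (deriv ^^ j) (F m z) field_differentiable (at t)) \<and>
    z * deriv (\<lambda>w. F m w t) z =
      (- t) ^ m * (\<Sum>j=0..m. 1 / fact j * of_nat (m choose j) * (t - 1) ^ j * (deriv ^^ j) (F m z) t)"
    (is "_ \<and> _ \<and> _ \<and> _ = _ * ?S")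
proof (intro conjI allI impI)
  have z: "norm z \<le> 1" and t: "t \<in> ball 0 (1 / 2)"
    using assms by auto
  show "summable (\<lambda>n. f m n z * t ^ n)"
    using summable_f_term[OF z assms(3)] .
  obtain D where D: "((\<lambda>w. F m w t) has_field_derivative D) (at z)"
      and sums_D: "(\<lambda>n. deriv (f m n) z * t ^ n) sums D"
    using F_has_field_derivative assms(2,3) by blast
  then show "(\<lambda>w. F m w t) field_differentiable (at z)"
    by (auto simp: field_differentiable_def)
  show "(deriv ^^ j) (F m z) field_differentiable (at t)" for j
    using holomorphic_higher_deriv[OF F_holomorphic[OF z] open_ball] t
    by (rule holomorphic_on_imp_differentiable_at[OF _ open_ball])

  define A where "A = Abs_fps (\<lambda>n. f m n z)"
  define B where "B = (1 - fps_X) ^ m * A"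
  \<comment> \<open>Multiplication by a polynomial does not shrink the disc of convergence, so
    \<open>B\<close> converges wherever |t| < 1/2.\<close>
  have radius_one_minus_X: "fps_conv_radius ((1 - fps_X) ^ m :: complex fps) = \<infinity>"
    using fps_conv_radius_power[of "1 - fps_X :: complex fps" m]
      fps_conv_radius_diff[of "1 :: complex fps" fps_X] by simp
  have radius_A: "ereal (1 / 2) \<le> fps_conv_radius A"
    unfolding A_def by (rule fps_conv_radius_f[OF z])
  have radius_B: "ereal (1 / 2) \<le> fps_conv_radius B"
    using fps_conv_radius_mult[of "(1 - fps_X) ^ m" A] radius_A
    by (simp add: B_def radius_one_minus_X)
  have norm_less: "ereal (norm w) < fps_conv_radius A" "ereal (norm w) < fps_conv_radius B"
    if "w \<in> ball 0 (1 / 2)" for w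
    using that radius_A radius_B by (auto intro: less_le_trans[of _ "ereal (1 / 2)"])

  \<comment> \<open>Coefficients from index \<open>m\<close> on suffice, because the
    \<open>m\<close>-th derivative of \<open>B\<close> does not see the lower ones.\<close>
  have B_nth: "fps_nth B (n + m) = (\<Sum>j\<le>n. of_nat (n choose j) * z ^ ((j + m) choose m))" for n
    using fps_one_minus_X_power_mult_binomial_transform[of m "\<lambda>j. z ^ (j choose m)" n]
    by (simp add: B_def A_def f_def atMost_atLeast0)
  \<comment> \<open>The sign reconciles \<open>t - 1\<close> in the claim with
    \<open>1 - fps_X\<close> in \<open>B\<close>. The equality is needed on the whole disc because
    it is differentiated \<open>m\<close> times.\<close>
  have eval_B: "(w - 1) ^ m * F m z w = (- 1) ^ m * eval_fps B w" if "w \<in> ball 0 (1 / 2)" for w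
  proof -
    have "eval_fps ((1 - fps_X) ^ m) w = (1 - w) ^ m"
      using fps_conv_radius_diff[of "1 :: complex fps" fps_X]
      by (simp add: eval_fps_power eval_fps_diff)
    then have "eval_fps B w = (1 - w) ^ m * F m z w"
      using norm_less[OF that]
      by (simp add: B_def eval_fps_mult radius_one_minus_X F_eq_eval_fps A_def)
    moreover have "(w - 1) ^ m = (- 1) ^ m * (1 - w) ^ m"
      by (simp flip: power_mult_distrib)
    ultimately show ?thesis by simp
  qed
  have holo_B: "eval_fps B holomorphic_on ball 0 (1 / 2)"
    using norm_less by (intro holomorphic_on_eval_fps) auto

  have "fact m * ?S = (deriv ^^ m) (\<lambda>w. (w - 1) ^ m * F m z w) t"
    by (rule higher_deriv_power_mult[OF F_holomorphic[OF z] open_ball t, symmetric])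
  also have "\<dots> = (deriv ^^ m) (\<lambda>w. (- 1) ^ m * eval_fps B w) t"
    by (rule higher_deriv_transform_within_open[OF _ _ open_ball t])
      (use eval_B F_holomorphic[OF z] holo_B in \<open>auto intro!: holomorphic_intros\<close>)
  also have "\<dots> = (- 1) ^ m * (deriv ^^ m) (eval_fps B) t"
    by (rule higher_deriv_cmult[OF holo_B t open_ball])
  also have "(deriv ^^ m) (eval_fps B) t = eval_fps (fps_nth_deriv m B) t"
    using norm_less[OF t] by (intro higher_deriv_eval_fps)
  finally have S: "fact m * ?S = (- 1) ^ m * eval_fps (fps_nth_deriv m B) t" .

  have "(\<lambda>n. z * deriv (f m n) z * t ^ n) sums (z * D)"
    using sums_mult[OF sums_D, of z] by (simp add: mult.assoc)
  \<comment> \<open>The first \<open>m\<close> terms are zero, so dropping them leaves the sum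
    unchanged and aligns the index with that of the \<open>m\<close>-th derivative.\<close>
  then have "(\<lambda>n. z * deriv (f m (n + m)) z * t ^ (n + m)) sums (z * D)"
    by (subst sums_zero_iff_shift) (auto simp: z_times_deriv_f_less)
  moreover have "(\<lambda>n. t ^ m / fact m * (fps_nth (fps_nth_deriv m B) n * t ^ n)) sums
      (t ^ m / fact m * eval_fps (fps_nth_deriv m B) t)"
    using norm_less(2)[OF t] fps_conv_radius_nth_deriv[of B m]
    by (intro sums_mult sums_eval_fps) auto
  moreover have "z * deriv (f m (n + m)) z * t ^ (n + m) =
      t ^ m / fact m * (fps_nth (fps_nth_deriv m B) n * t ^ n)" for n
    by (simp add: z_times_deriv_f_add fps_nth_deriv_nth B_nth power_add)
  ultimately have "z * D = t ^ m / fact m * eval_fps (fps_nth_deriv m B) t"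
    by (simp add: sums_unique2)
  \<comment> \<open>This solves \<open>S\<close> for the series, using that \<open>(- 1) ^ m\<close>
    is its own inverse.\<close>
  also have "eval_fps (fps_nth_deriv m B) t = (- 1) ^ m * (fact m * ?S)"
    unfolding S by (simp flip: power_mult_distrib mult.assoc)
  also have "t ^ m / fact m * \<dots> = (- t) ^ m * ?S"
    by (simp add: power_minus[of t])
  finally show "z * deriv (\<lambda>w. F m w t) z = (- t) ^ m * ?S"
    using DERIV_imp_deriv[OF D] by simp
qed

end
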